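(* Let $p$ be a prime, $0<\rho<1$, $c\in\mathbb{R}$, $M=\begin{bmatrix}\rho^{-1} & c\\ 0 & \rho^{-1}\end{bmatrix}$, and let $D=\{d_0,d_1,\dots,d_{p-1}\}\subset\mathbb{Z}^2$ be a set of $p$ distinct vectors such that $\mathcal{Z}(\widehat{\delta}_D)=\bigcup_{j=1}^{p-1}\left(\frac{j\bm{a}}{p}+\mathbb{Z}^2\right)$ for some $\bm{a}\in\mathcal{E}_p$. Let $\mu_{M,D}$ be the associated self-affine measure. Suppose $\rho^{-1}=\left(\frac{t}{s}\right)^{1/r}$ for some $s,t,r\in\mathbb{N}$ with $\gcd(s,t)=1$. Then the following statements hold. (i) If $c\neq\kappa\rho^{-1}$ for every $\kappa\in\mathbb{Q}$, then there exist at most $p$ mutually orthogonal exponential functions in $L^2(\mu_{M,D})$, and the number $p$ is the best (i.e. there do exist $p$ mutually orthogonal exponential functions). (ii) If $c=\kappa\rho^{-1}$ for some $\kappa\in\mathbb{Q}$ and $t\notin p\mathbb{Z}$, then: (a) if $s\notin p\mathbb{Z}$, there exist at most $p$ mutually orthogonal exponential functions in $L^2(\mu_{M,D})$, and the number $p$ is the best; (b) if $s\in p\mathbb{Z}$, there are any number of orthogonal exponential functions in $L^2(\mu_{M,D})$ (i.e. for every $N\in\mathbb{N}$ there exist $N$ mutually orthogonal exponential functions in $L^2(\mu_{M,D})$).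
   Context: $\mathbb{N}=\{1,2,3,\dots\}$ here. $v^*$ denotes the (conjugate) transpose, so $(i_1,i_2)^*$ is a column vector. $\mathcal{E}_p=\{(i_1,i_2)^*: i_1,i_2\in\{1,\dots,p-1\}\}$. For a finite set $E\subset\mathbb{R}^2$, $\delta_E=\frac{1}{\#E}\sum_{e\in E}\delta_e$, where $\delta_e$ is the Dirac measure at $e$. For a compactly supported Borel probability measure $\mu$ on $\mathbb{R}^2$, $\widehat{\mu}(\xi)=\int e^{-2\pi i\langle\xi,x\rangle}\,d\mu(x)$, $\xi\in\mathbb{R}^2$; $\mathcal{Z}(f)$ is the set of zeros of $f$ in $\mathbb{R}^2$. The self-affine measure $\mu_{M,D}$ is the unique Borel probability measure satisfying $\mu=\frac{1}{\#D}\sum_{d\in D}\mu\circ\varphi_d^{-1}$ with $\varphi_d(x)=M^{-1}(x+d)$. An exponential function is a function $x\mapsto e^{-2\pi i\langle\lambda,x\rangle}$ with $\lambda\in\mathbb{R}^2$. *)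

theory Defs
  imports "HOL-Probability.Probability"
begin

definition integer_lattice :: "(real^2) set" where
  "integer_lattice = {x. \<forall>i. x $ i \<in> \<int>}"

definition E_set :: "nat \<Rightarrow> (real^2) set" where
  "E_set p = {vector [real i, real j] | i j. i \<in> {1..p - 1} \<and> j \<in> {1..p - 1}}"

definition zero_set :: "(real^2 \<Rightarrow> complex) \<Rightarrow> (real^2) set" where
  "zero_set f = {\<xi>. f \<xi> = 0}"

definition uniform_dirac :: "(real^2) set \<Rightarrow> (real^2) measure" where
  "uniform_dirac E = measure_of UNIV (sets borel)
     (\<lambda>A. (\<Sum>e\<in>E. emeasure (return borel e) A) / of_nat (card E))"

text \<open>The set function in the definition above is countably additive, so that
  \<^const>\<open>measure_of\<close> does not fall back to the null measure.\<close>

lemma sets_uniform_dirac [simp, measurable_cong]: "sets (uniform_dirac E) = sets borel"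
  and space_uniform_dirac [simp]: "space (uniform_dirac E) = UNIV"
  unfolding uniform_dirac_def
  by (metis sets.sets_measure_of_eq space_borel) (simp add: space_measure_of_conv)

lemma emeasure_uniform_dirac:
  assumes "A \<in> sets borel"
  shows "emeasure (uniform_dirac E) A = (\<Sum>e\<in>E. emeasure (return borel e) A) / of_nat (card E)"
proof (rule emeasure_measure_of[OF uniform_dirac_def])
  show "countably_additive (sets (uniform_dirac E))
     (\<lambda>A. (\<Sum>e\<in>E. emeasure (return borel e) A) / of_nat (card E))"
  proof (rule countably_additiveI)
    fix F :: "nat \<Rightarrow> (real^2) set"
    assume F: "range F \<subseteq> sets (uniform_dirac E)" "disjoint_family F"
    have "(\<Sum>i. emeasure (return borel e) (F i)) = emeasure (return borel e) (\<Union>(range F))"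
      for e :: "real^2"
      using F by (intro suminf_emeasure) auto
    then show "(\<Sum>i. (\<Sum>e\<in>E. emeasure (return borel e) (F i)) / of_nat (card E))
        = (\<Sum>e\<in>E. emeasure (return borel e) (\<Union>(range F))) / of_nat (card E)"
      by (simp add: ennreal_suminf_divide suminf_sum)
  qed
qed (use assms in \<open>auto simp: positive_def sets_eq_imp_space_eq\<close>)

definition fourier :: "(real^2) measure \<Rightarrow> real^2 \<Rightarrow> complex" where
  "fourier \<mu> \<xi> = (LINT x|\<mu>. exp (- 2 * of_real pi * \<i> * of_real (\<xi> \<bullet> x)))"

definition self_affine_measure ::
  "real^2^2 \<Rightarrow> (real^2) set \<Rightarrow> (real^2) measure \<Rightarrow> bool" where
  "self_affine_measure M D \<mu> \<longleftrightarrow>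
     prob_space \<mu> \<and> sets \<mu> = sets borel \<and>
     (\<forall>A \<in> sets borel. emeasure \<mu> A =
        (\<Sum>d\<in>D. emeasure (distr \<mu> borel (\<lambda>x. matrix_inv M *v (x + d))) A) / of_nat (card D))"

definition exponential :: "real^2 \<Rightarrow> real^2 \<Rightarrow> complex" where
  "exponential lam = (\<lambda>x. exp (- 2 * of_real pi * \<i> * of_real (lam \<bullet> x)))"

text \<open>Distinct frequencies give distinct functions on the plane, and orthogonal exponentials
  are distinct in \<open>L\<^sup>2(\<mu>)\<close> because each has norm 1 for a probability measure \<open>\<mu>\<close>; so
  counting functions in the set \<open>F\<close> is the same as counting elements of \<open>L\<^sup>2(\<mu>)\<close>.\<close>

definition orthogonal_exponentials ::
  "(real^2) measure \<Rightarrow> (real^2 \<Rightarrow> complex) set \<Rightarrow> bool" where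
  "orthogonal_exponentials \<mu> F \<longleftrightarrow>
     F \<subseteq> range exponential \<and> pairwise (\<lambda>f g. (LINT x|\<mu>. f x * cnj (g x)) = 0) F"

end

theory Submission
  imports Defs "HOL-Computational_Algebra.Fundamental_Theorem_Algebra"
    "HOL-Computational_Algebra.Primes"
begin

text \<open>
  Put \<open>R = 1 / \<rho>\<close> and \<open>\<kappa> = c \<rho>\<close>, so that \<open>(M\<^sup>T)\<^sup>n (x, y) = R ^ n (x, y + n \<kappa> x)\<close>. Two exponentials are
  orthogonal if and only if the Fourier transform of \<open>\<mu>\<close> vanishes at the difference of their
  frequencies. This transform is the product over \<open>n \<ge> 1\<close> of the transform of the digit measure
  evaluated at \<open>(M\<^sup>T)\<^sup>-\<^sup>n \<xi>\<close>, so its zeros are the points \<open>(M\<^sup>T)\<^sup>n w\<close>, where \<open>w\<close> runs through the zeros of the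
  digit transform (\<open>fourier_zero_iff\<close>); such a point is said to have level \<open>n\<close>. By hypothesis the
  coordinates of \<open>w\<close> are rational, and the first one has \<open>p\<close>-adic valuation \<open>-1\<close>.

  For the upper bounds, let all differences of a set of frequencies have levels, and look at their first
  coordinates \<open>R ^ n k / p\<close>. For three frequencies these give a relation \<open>\<alpha> + \<beta> = 1\<close> between two
  quotients whose \<open>r\<close>-th powers are rational, because \<open>R ^ r = t / s\<close>. Hence \<open>\<alpha>\<close> and \<open>\<beta>\<close> are
  rational (\<open>Rats_if_radicals_add_to_1\<close>), and their valuations can be computed from the levels. If \<open>p\<close>
  divides neither \<open>s\<close> nor \<open>t\<close>, then all normalised differences are \<open>p\<close>-adic units, whatever \<open>\<kappa>\<close> is. If
  \<open>p\<close> divides one of them and \<open>\<kappa>\<close> is irrational, then the second coordinates, together with the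
  ultrametric law, force all levels to be equal (\<open>same_level\<close>), and normalised differences are
  again \<open>p\<close>-adic units. A set of numbers whose differences are \<open>p\<close>-adic units has at most \<open>p\<close>
  elements (\<open>card_le_if_differences_padic_units\<close>).

  As to existence, the \<open>p\<close> frequencies \<open>M\<^sup>T (j a / p)\<close>, \<open>0 \<le> j < p\<close>, always give orthogonal exponentials.
  If \<open>p\<close> divides \<open>s\<close> and not \<open>t\<close>, and \<open>\<kappa>\<close> has the denominator \<open>B\<close>, then so do the \<open>N\<close> frequencies
  \<open>(M\<^sup>T)\<^bsup>r B k\<^esup> (t ^ (B N) a / p)\<close>, \<open>1 \<le> k \<le> N\<close>: for two of them, pulling back by the
  higher power of \<open>M\<^sup>T\<close> turns the frequency of lower level into a lattice vector
  (\<open>shear_scale_multiple_in_lattice\<close>), and the zeros of the digit transform are invariant under the lattice.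
\<close>

section \<open>Fourier transforms of averages and of self-affine measures\<close>

text \<open>
  An average of finitely many probability measures \<open>\<nu> e\<close> is the Giry-monad bind of the uniform
  distribution on \<open>E\<close> with \<open>\<nu>\<close>, so integrals of nonnegative functions average. Adding the bound \<open>B\<close>
  makes a bounded real function nonnegative. Both \<^const>\<open>uniform_dirac\<close> and a self-affine measure
  are given by such set functions.
\<close>

lemma LINT_real_uniform_mixture:
  fixes g :: "'a \<Rightarrow> real"
  assumes E: "finite E" "E \<noteq> {}"
    and sets: "sets \<mu> = sets N" and \<mu>: "prob_space \<mu>"
    and \<nu>: "\<And>e. prob_space (\<nu> e)" "\<And>e. sets (\<nu> e) = sets N"
    and mix: "\<And>A. A \<in> sets N \<Longrightarrow> emeasure \<mu> A = (\<Sum>e\<in>E. emeasure (\<nu> e) A) / of_nat (card E)"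
    and g: "g \<in> borel_measurable N" "\<And>x. \<bar>g x\<bar> \<le> B"
  shows "(LINT x|\<mu>. g x) = (\<Sum>e\<in>E. LINT x|\<nu> e. g x) / real (card E)"
proof -
  define h where "h x = g x + B" for x
  have h: "h \<in> borel_measurable N" "\<And>x. 0 \<le> h x"
  proof -
    show "h \<in> borel_measurable N" unfolding h_def by (intro borel_measurable_add g(1)) simp
    show "0 \<le> h x" for x using g(2)[of x] by (simp add: h_def)
  qed
  have B: "\<bar>g x\<bar> \<le> \<bar>B\<bar>" "\<bar>h x\<bar> \<le> 2 * \<bar>B\<bar>" for x
    using g(2)[of x] by (auto simp: h_def)
  have space: "space \<mu> = space N" "space (\<nu> e) = space N" for e
    using sets \<nu>(2) by (auto dest: sets_eq_imp_space_eq)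
  have int: "integrable P g" "integrable P h" "(LINT x|P. h x) = (LINT x|P. g x) + B"
    if P: "prob_space P" "sets P = sets N" for P
  proof -
    interpret prob_space P by fact
    have m: "g \<in> borel_measurable P" "h \<in> borel_measurable P"
      using g(1) h(1) P(2) by (simp_all cong: measurable_cong_sets)
    show i: "integrable P g"
      by (rule integrable_const_bound[of _ "\<bar>B\<bar>"]) (use B(1) m(1) in \<open>simp_all only: real_norm_def AE_I2\<close>)
    show "integrable P h"
      by (rule integrable_const_bound[of _ "2 * \<bar>B\<bar>"]) (use B(2) m(2) in \<open>simp_all only: real_norm_def AE_I2\<close>)
    show "(LINT x|P. h x) = (LINT x|P. g x) + B"
      unfolding h_def using i(1) by (simp add: prob_space)
  qed
  have meas: "\<nu> \<in> measure_pmf (pmf_of_set E) \<rightarrow>\<^sub>M subprob_algebra N"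
    using \<nu> by (auto simp: space_subprob_algebra prob_space_imp_subprob_space)
  have bind: "\<mu> = measure_pmf (pmf_of_set E) \<bind> \<nu>"
  proof (rule measure_eqI)
    show "sets \<mu> = sets (measure_pmf (pmf_of_set E) \<bind> \<nu>)"
      using \<nu>(2) by (simp add: sets sets_bind[of _ _ N])
    show "emeasure \<mu> A = emeasure (measure_pmf (pmf_of_set E) \<bind> \<nu>) A" if "A \<in> sets \<mu>" for A
      using that E by (simp add: emeasure_bind[OF _ meas] sets mix nn_integral_pmf_of_set)
  qed
  have "ennreal (LINT x|\<mu>. h x) = (\<integral>\<^sup>+x. h x \<partial>\<mu>)"
    using int(2)[OF \<mu> sets] h(2) by (simp add: nn_integral_eq_integral)
  also have "\<dots> = (\<Sum>e\<in>E. \<integral>\<^sup>+x. h x \<partial>\<nu> e) / of_nat (card E)"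
    using h(1) E by (subst bind, subst nn_integral_bind[OF _ meas])
      (auto simp: nn_integral_pmf_of_set)
  also have "\<dots> = (\<Sum>e\<in>E. ennreal (LINT x|\<nu> e. h x)) / of_nat (card E)"
    using int(2)[OF \<nu>] h(2) by (simp add: nn_integral_eq_integral)
  also have "\<dots> = ennreal ((\<Sum>e\<in>E. LINT x|\<nu> e. h x) / real (card E))"
    using E h(2) by (subst sum_ennreal)
      (auto simp: ennreal_of_nat_eq_real_of_nat card_gt_0_iff sum_nonneg divide_ennreal)
  finally have "(LINT x|\<mu>. h x) = (\<Sum>e\<in>E. LINT x|\<nu> e. h x) / real (card E)"
    using h(2) by (subst (asm) ennreal_inj) (auto intro!: divide_nonneg_nonneg sum_nonneg)
  then show ?thesis
    using E by (simp add: int(3)[OF \<mu> sets] int(3)[OF \<nu>] sum.distrib add_divide_distrib)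
qed

lemma LINT_complex_uniform_mixture:
  fixes f :: "'a \<Rightarrow> complex"
  assumes E: "finite E" "E \<noteq> {}"
    and sets: "sets \<mu> = sets N" and \<mu>: "prob_space \<mu>"
    and \<nu>: "\<And>e. prob_space (\<nu> e)" "\<And>e. sets (\<nu> e) = sets N"
    and mix: "\<And>A. A \<in> sets N \<Longrightarrow> emeasure \<mu> A = (\<Sum>e\<in>E. emeasure (\<nu> e) A) / of_nat (card E)"
    and f: "f \<in> borel_measurable N" "\<And>x. norm (f x) \<le> B"
  shows "(LINT x|\<mu>. f x) = (\<Sum>e\<in>E. LINT x|\<nu> e. f x) / of_nat (card E)"
proof -
  have int: "integrable P f" if P: "prob_space P" "sets P = sets N" for P
  proof -
    interpret prob_space P by fact
    have "f \<in> borel_measurable P"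
      using f(1) P(2) by (simp cong: measurable_cong_sets)
    then show ?thesis using f(2) by (auto intro!: integrable_const_bound[of _ B])
  qed
  have Re: "Re (LINT x|P. f x) = (LINT x|P. Re (f x))"
    and Im: "Im (LINT x|P. f x) = (LINT x|P. Im (f x))"
    if P: "prob_space P" "sets P = sets N" for P
    using int[OF P] by (simp_all add: integral_bounded_linear[OF bounded_linear_Re]
      integral_bounded_linear[OF bounded_linear_Im])
  have "\<bar>Re (f x)\<bar> \<le> B" "\<bar>Im (f x)\<bar> \<le> B" for x
    using f(2)[of x] abs_Re_le_cmod[of "f x"] abs_Im_le_cmod[of "f x"] by linarith+
  moreover have "(\<lambda>x. Re (f x)) \<in> borel_measurable N" "(\<lambda>x. Im (f x)) \<in> borel_measurable N"
    using f(1) by measurable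
  ultimately show ?thesis
    using LINT_real_uniform_mixture[OF E sets \<mu> \<nu> mix, of "\<lambda>x. Re (f x)" B]
      LINT_real_uniform_mixture[OF E sets \<mu> \<nu> mix, of "\<lambda>x. Im (f x)" B]
    by (simp add: complex_eq_iff Re[OF \<mu> sets] Im[OF \<mu> sets] Re[OF \<nu>] Im[OF \<nu>]
      Re_divide_of_nat Im_divide_of_nat)
qed

lemma borel_measurable_exponential [measurable]: "exponential lam \<in> borel_measurable borel"
  unfolding exponential_def by measurable

lemma norm_exponential [simp]: "norm (exponential lam x) = 1"
  by (simp add: exponential_def)

lemma fourier_eq: "fourier \<mu> \<xi> = (LINT x|\<mu>. exponential \<xi> x)"
  by (simp add: fourier_def exponential_def)

lemma exponential_add: "exponential lam (x + y) = exponential lam x * exponential lam y"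
  by (simp add: exponential_def inner_add_right ring_distribs flip: exp_add)

lemma fourier_uniform_dirac:
  assumes "finite E" "E \<noteq> {}"
  shows "fourier (uniform_dirac E) \<xi> = (\<Sum>e\<in>E. exponential \<xi> e) / of_nat (card E)"
proof -
  have "prob_space (uniform_dirac E)"
    using assms by (intro prob_spaceI) (simp add: emeasure_uniform_dirac
      ennreal_of_nat_eq_real_of_nat divide_ennreal)
  then have "fourier (uniform_dirac E) \<xi> =
      (\<Sum>e\<in>E. LINT x|return borel e. exponential \<xi> x) / of_nat (card E)"
    unfolding fourier_eq using assms
    by (intro LINT_complex_uniform_mixture[where N = borel and B = 1])
      (auto simp: prob_space_return emeasure_uniform_dirac)
  then show ?thesis by (simp add: integral_return)
qed

text \<open>
  The Fourier side of self-affinity. Translating by \<open>d\<close> produces the factor \<open>exponential \<eta> d\<close>, whose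
  average over \<open>D\<close> is the transform of the digit measure; iterating this identity
  exhibits \<open>fourier \<mu>\<close> as an infinite product.
\<close>

lemma fourier_self_affine:
  assumes D: "finite D" "D \<noteq> {}" and \<mu>: "self_affine_measure M D \<mu>"
  shows "fourier \<mu> \<xi> = fourier (uniform_dirac D) (transpose (matrix_inv M) *v \<xi>)
           * fourier \<mu> (transpose (matrix_inv M) *v \<xi>)"
proof -
  define \<eta> where "\<eta> = transpose (matrix_inv M) *v \<xi>"
  have \<mu>': "prob_space \<mu>" "sets \<mu> = sets borel"
    using \<mu> by (auto simp: self_affine_measure_def)
  have meas: "(\<lambda>x. matrix_inv M *v (x + d)) \<in> borel_measurable \<mu>" for d
  proof -
    have "(\<lambda>x. matrix_inv M *v (x + d)) \<in> borel_measurable borel"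
      by (intro borel_measurable_continuous_onI continuous_intros
          linear_continuous_on_compose[OF _ matrix_vector_mul_linear]) 
    then show ?thesis using \<mu>'(2) by (simp cong: measurable_cong_sets)
  qed
  have \<eta>: "exponential \<xi> (matrix_inv M *v y) = exponential \<eta> y" for y
    by (simp add: exponential_def \<eta>_def dot_lmul_matrix[symmetric])
  have "fourier \<mu> \<xi> =
      (\<Sum>d\<in>D. LINT x|distr \<mu> borel (\<lambda>x. matrix_inv M *v (x + d)). exponential \<xi> x) / of_nat (card D)"
    unfolding fourier_eq using D \<mu>' \<mu> meas
    by (intro LINT_complex_uniform_mixture[where N = borel and B = 1])
      (auto simp: self_affine_measure_def prob_space.prob_space_distr)
  also have "(\<lambda>d. LINT x|distr \<mu> borel (\<lambda>x. matrix_inv M *v (x + d)). exponential \<xi> x)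
      = (\<lambda>d. exponential \<eta> d * fourier \<mu> \<eta>)"
    by (rule ext, subst integral_distr[OF meas]) (simp_all add: \<eta> exponential_add fourier_eq mult.commute)
  also have "(\<Sum>d\<in>D. exponential \<eta> d * fourier \<mu> \<eta>) / of_nat (card D)
      = fourier (uniform_dirac D) \<eta> * fourier \<mu> \<eta>"
    using D by (simp add: fourier_uniform_dirac sum_distrib_right)
  finally show ?thesis by (simp add: \<eta>_def)
qed

lemma fourier_tendsto_1:
  assumes \<mu>: "prob_space \<mu>" "sets \<mu> = sets borel" and X: "X \<longlonglongrightarrow> 0"
  shows "(\<lambda>n. fourier \<mu> (X n)) \<longlonglongrightarrow> 1"
proof -
  interpret prob_space \<mu> by fact
  have "exponential lam \<in> borel_measurable \<mu>" for lam
    using \<mu>(2) by (simp cong: measurable_cong_sets)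
  moreover have "(\<lambda>n. exponential (X n) x) \<longlonglongrightarrow> 1" for x
  proof -
    have "(\<lambda>n. exponential (X n) x) \<longlonglongrightarrow> exp (- 2 * of_real pi * \<i> * of_real (0 \<bullet> x))"
      unfolding exponential_def by (intro tendsto_intros X)
    then show ?thesis by simp
  qed
  ultimately have "(\<lambda>n. LINT x|\<mu>. exponential (X n) x) \<longlonglongrightarrow> (LINT x|\<mu>. 1)"
    by (intro integral_dominated_convergence[where w = "\<lambda>_. 1"]) auto
  then show ?thesis by (simp add: fourier_eq prob_space)
qed

section \<open>Valuations of rational numbers\<close>

text \<open>
  The \<open>p\<close>-adic valuation of a real number that happens to be rational, as a relation: it has no value
  at irrational numbers and at \<open>0\<close>, so it carries rationality along with the exponent.
\<close>

definition padic_val :: "nat \<Rightarrow> int \<Rightarrow> real \<Rightarrow> bool" where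
  "padic_val p k x \<longleftrightarrow> (\<exists>a b::int. \<not> int p dvd a \<and> \<not> int p dvd b \<and>
     x = real p powi k * (of_int a / of_int b))"

lemma padic_valI:
  "\<not> int p dvd a \<Longrightarrow> \<not> int p dvd b \<Longrightarrow> x = real p powi k * (of_int a / of_int b) \<Longrightarrow> padic_val p k x"
  unfolding padic_val_def by blast

lemma padic_val_imp_Rats: "padic_val p k x \<Longrightarrow> x \<in> \<rat>"
  by (auto simp: padic_val_def power_int_def)

context
  fixes p :: nat
  assumes p: "prime p"
begin

lemma prime_int_p: "prime (int p)" and p_pos: "real p > 0"
  using p prime_gt_0_nat by auto

lemma not_dvd_1: "\<not> int p dvd 1"
  using prime_int_p not_prime_unit by blast

lemma padic_val_minus_1: "padic_val p 0 (- 1)"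
  using not_dvd_1 by (intro padic_valI[of p "-1" 1]) auto

lemma padic_val_nonzero: "padic_val p k x \<Longrightarrow> x \<noteq> 0"
  using p_pos by (auto simp: padic_val_def)

lemma padic_val_of_int: "\<not> int p dvd a \<Longrightarrow> padic_val p 0 (of_int a)"
  using not_dvd_1 by (intro padic_valI[of p a 1]) auto

lemma padic_val_1: "padic_val p 0 1"
  using padic_val_of_int[of 1] not_dvd_1 by simp

lemma padic_val_mult:
  assumes "padic_val p k x" "padic_val p l y"
  shows "padic_val p (k + l) (x * y)"
proof -
  from assms obtain a b c d :: int where *:
    "\<not> int p dvd a" "\<not> int p dvd b" "x = real p powi k * (of_int a / of_int b)"
    "\<not> int p dvd c" "\<not> int p dvd d" "y = real p powi l * (of_int c / of_int d)"
    unfolding padic_val_def by blast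
  show ?thesis
    using * p_pos by (intro padic_valI[of p "a * c" "b * d"])
      (auto simp: prime_dvd_mult_iff[OF prime_int_p] power_int_add)
qed

lemma padic_val_inverse:
  assumes "padic_val p k x"
  shows "padic_val p (- k) (inverse x)"
proof -
  from assms obtain a b :: int where *:
    "\<not> int p dvd a" "\<not> int p dvd b" "x = real p powi k * (of_int a / of_int b)"
    unfolding padic_val_def by blast
  show ?thesis
    using * by (intro padic_valI[of p b a]) (auto simp: power_int_minus field_simps)
qed

lemma padic_val_divide:
  "padic_val p k x \<Longrightarrow> padic_val p l y \<Longrightarrow> padic_val p (k - l) (x / y)"
  using padic_val_mult[OF _ padic_val_inverse] by (auto simp: divide_inverse)

lemma padic_val_power: "padic_val p k x \<Longrightarrow> padic_val p (int n * k) (x ^ n)"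
proof (induction n)
  case 0 show ?case using padic_val_1 by simp
next
  case (Suc n)
  then show ?case using padic_val_mult[of k x "int n * k" "x ^ n"] by (simp add: algebra_simps)
qed

lemma padic_val_power_int: "padic_val p k x \<Longrightarrow> padic_val p (n * k) (x powi n)"
  using padic_val_power[of k x "nat n"] padic_val_power[of "-k" "inverse x" "nat (-n)"]
    padic_val_inverse[of k x]
  by (cases "n \<ge> 0") (auto simp: power_int_def)

lemma padic_val_add:
  assumes "padic_val p k x" "padic_val p l y" "k < l"
  shows "padic_val p k (x + y)"
proof -
  from assms obtain a b c d :: int where *:
    "\<not> int p dvd a" "\<not> int p dvd b" "x = real p powi k * (of_int a / of_int b)"
    "\<not> int p dvd c" "\<not> int p dvd d" "y = real p powi l * (of_int c / of_int d)"
    unfolding padic_val_def by blast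
  define m where "m = nat (l - k)"
  have m: "l = k + int m" "m > 0" using assms(3) by (auto simp: m_def)
  have nz: "b \<noteq> 0" "d \<noteq> 0" using * by auto
  show ?thesis
  proof (rule padic_valI)
    have "int p dvd int p ^ m * (b * c)" using m(2) by (simp add: dvd_power)
    moreover have "\<not> int p dvd a * d" using * by (simp add: prime_dvd_mult_iff[OF prime_int_p])
    ultimately show "\<not> int p dvd a * d + int p ^ m * (b * c)"
      by (simp add: dvd_add_left_iff)
    show "\<not> int p dvd b * d" using * by (simp add: prime_dvd_mult_iff[OF prime_int_p])
    show "x + y = real p powi k * (of_int (a * d + int p ^ m * (b * c)) / of_int (b * d))"
      using nz p_pos by (simp add: * m(1) power_int_add field_simps)
  qed
qed

lemma padic_val_unique:
  assumes "padic_val p k x" "padic_val p l x"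
  shows "k = l"
proof -
  have *: False if lt: "i < j" and i: "padic_val p i x" and j: "padic_val p j x" for i j
  proof -
    have "padic_val p j (- x)"
      using padic_val_mult[OF padic_val_minus_1 j] by simp
    then have "padic_val p i (x + - x)" by (rule padic_val_add[OF i _ lt])
    then show False using padic_val_nonzero[of i 0] by simp
  qed
  show ?thesis using *[OF _ assms] *[OF _ assms(2,1)] by (cases k l rule: linorder_cases) auto
qed

lemma padic_val_of_nat_exists:
  assumes "n > 0"
  obtains k where "padic_val p (int k) (of_nat n)" "k > 0 \<longleftrightarrow> p dvd n"
proof -
  obtain y where y: "n = p ^ multiplicity p n * y" "\<not> p dvd y"
    using multiplicity_decompose'[of n p] assms prime_gt_1_nat[OF p] by auto
  have "padic_val p (int (multiplicity p n)) (of_nat n)"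
    using y not_dvd_1 by (intro padic_valI[of p "int y" 1]) (auto simp flip: of_nat_power of_nat_mult)
  then show thesis
    using assms p by (intro that) (auto simp: prime_multiplicity_gt_zero_iff)
qed

lemma padic_val_exists:
  assumes "x \<in> \<rat>" "x \<noteq> 0"
  obtains k where "padic_val p k x"
proof -
  from assms obtain a b :: int where ab: "x = of_int a / of_int b" "b \<noteq> 0" "a \<noteq> 0"
    by (auto elim!: Rats_cases')
  have *: "\<exists>k. padic_val p k (of_int c)" if "c \<noteq> 0" for c
  proof -
    have "nat \<bar>c\<bar> > 0" using that by simp
    then obtain k where "padic_val p (int k) (real (nat \<bar>c\<bar>))"
      by (rule padic_val_of_nat_exists)
    moreover have "padic_val p 0 (sgn (of_int c))"
      using padic_val_1 padic_val_minus_1 that by (auto simp: sgn_if)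
    ultimately have "padic_val p (int k + 0) (real (nat \<bar>c\<bar>) * sgn (of_int c))"
      by (rule padic_val_mult)
    moreover have "real (nat \<bar>c\<bar>) * sgn (of_int c) = of_int c" by (simp add: sgn_if)
    ultimately show ?thesis by auto
  qed
  obtain k l where "padic_val p k (of_int a)" "padic_val p l (of_int b)"
    using *[OF ab(3)] *[OF ab(2)] by blast
  then show thesis using that padic_val_divide ab(1) by blast
qed

text \<open>
  This carries information about \<open>\<rho> ^ r\<close>, which is rational, down to quantities built from powers of
  \<open>\<rho>\<close>. Those may be irrational in general, and then have no valuation at all, so rationality of the
  base has to be known beforehand.
\<close>

lemma padic_val_of_power:
  assumes "x \<in> \<rat>" "padic_val p k (x ^ n)"
  obtains l where "padic_val p l x" "int n * l = k" | "n = 0"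
proof (cases "n = 0")
  case False
  then have "x \<noteq> 0" using padic_val_nonzero[OF assms(2)] by auto
  then obtain l where l: "padic_val p l x" using padic_val_exists assms(1) by blast
  then show thesis using padic_val_unique[OF padic_val_power[OF l] assms(2)] that by blast
qed

text \<open>
  The pigeonhole principle behind every upper bound. All values of \<open>f\<close> differ from a fixed one by
  fractions \<open>a / b\<close> with \<open>b\<close> prime to \<open>p\<close>, which have a residue modulo \<open>p\<close>; two equal residues
  would make a difference that is not a \<open>p\<close>-adic unit.
\<close>

lemma card_le_if_differences_padic_units:
  fixes f :: "'a \<Rightarrow> real"
  assumes unit: "\<And>x y. x \<in> L \<Longrightarrow> y \<in> L \<Longrightarrow> x \<noteq> y \<Longrightarrow> padic_val p 0 (f x - f y)"
  shows "finite L \<and> card L \<le> p"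
proof (cases "L = {}")
  case False
  then obtain x0 where o: "x0 \<in> L" by blast
  \<comment> \<open>Such a \<open>k\<close> is the residue of \<open>f x - f x0\<close>, namely \<open>a\<close> times the inverse of \<open>b\<close> modulo \<open>p\<close>.\<close>
  have "\<exists>k\<in>{0..<int p}. \<exists>a b. \<not> int p dvd b \<and> int p dvd a - k * b \<and> f x - f x0 = of_int a / of_int b"
    if x: "x \<in> L" for x
  proof -
    have "\<exists>a b. \<not> int p dvd b \<and> f x - f x0 = of_int a / of_int b"
    proof (cases "x = x0")
      case True
      then show ?thesis using not_dvd_1 by (intro exI[of _ 0] exI[of _ 1]) auto
    next
      case False
      then show ?thesis using unit[OF x o] by (auto simp: padic_val_def)
    qed
    then obtain a b where ab: "\<not> int p dvd b" "f x - f x0 = of_int a / of_int b" by blast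
    then have "coprime b (int p)" using prime_imp_coprime[OF prime_int_p] coprime_commute by blast
    then obtain u v where "u * b + v * int p = 1" using bezout_int[of b "int p"] by auto
    then have "1 - b * u = int p * v" by (simp add: algebra_simps)
    then have "int p dvd a * (1 - b * u) + int p * (a * u div int p) * b" by simp
    also have "a * (1 - b * u) + int p * (a * u div int p) * b = a - (a * u mod int p) * b"
      by (simp add: minus_div_mult_eq_mod[symmetric] algebra_simps)
    finally have "int p dvd a - (a * u mod int p) * b" .
    moreover have "a * u mod int p \<in> {0..<int p}" using p prime_gt_0_nat by simp
    ultimately show ?thesis using ab by blast
  qed
  then obtain k where k: "\<And>x. x \<in> L \<Longrightarrow> k x \<in> {0..<int p}"
    "\<And>x. x \<in> L \<Longrightarrow> \<exists>a b. \<not> int p dvd b \<and> int p dvd a - k x * b \<and> f x - f x0 = of_int a / of_int b"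
    by metis
  have "inj_on k L"
  proof (rule inj_onI, rule ccontr)
    fix x y assume xy: "x \<in> L" "y \<in> L" "k x = k y" "x \<noteq> y"
    obtain a b where ab: "\<not> int p dvd b" "int p dvd a - k x * b" "f x - f x0 = of_int a / of_int b"
      using k(2) xy(1) by blast
    obtain c d where cd: "\<not> int p dvd d" "int p dvd c - k x * d" "f y - f x0 = of_int c / of_int d"
      using k(2)[OF xy(2)] xy(3) by auto
    obtain m n where mn: "\<not> int p dvd m" "\<not> int p dvd n" "f x - f y = of_int m / of_int n"
      using unit[OF xy(1,2,4)] by (auto simp: padic_val_def)
    have nz: "b \<noteq> 0" "d \<noteq> 0" "n \<noteq> 0" using ab cd mn by auto
    have "real_of_int a / of_int b - of_int c / of_int d = of_int m / of_int n"
      using ab(3) cd(3) mn(3) by simp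
    then have "real_of_int ((a * d - c * b) * n) = of_int (m * (b * d))"
      using nz by (simp add: field_simps)
    then have eq: "(a * d - c * b) * n = m * (b * d)" by (simp only: of_int_eq_iff)
    have "a * d - c * b = (a - k x * b) * d - (c - k x * d) * b" by (simp add: algebra_simps)
    then have "int p dvd a * d - c * b" using ab(2) cd(2) by simp
    then have "int p dvd m * (b * d)" by (metis eq dvd_mult2)
    then show False using ab cd mn by (simp add: prime_dvd_mult_iff[OF prime_int_p])
  qed
  moreover have "k ` L \<subseteq> {0..<int p}" using k(1) by blast
  ultimately show ?thesis
    using card_inj_on_le[of k L "{0..<int p}"] inj_on_finite[of k L "{0..<int p}"] by auto
qed auto

end


section \<open>Real radicals with sum one\<close>

text \<open>
  Evaluation of rational polynomials at complex points: divisions have to take place over the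
  rationals, while the argument below needs all complex roots.
\<close>

definition rat_eval :: "rat poly \<Rightarrow> complex \<Rightarrow> complex" where
  "rat_eval q z = poly (map_poly of_rat q) z"

lemma rat_eval_simps [simp]:
  "rat_eval 0 z = 0" "rat_eval (pCons a q) z = of_rat a + z * rat_eval q z"
  by (simp_all add: rat_eval_def map_poly_pCons)

lemma rat_eval_add: "rat_eval (q + r) z = rat_eval q z + rat_eval r z"
  by (induction q r rule: poly_induct2) (simp_all add: of_rat_add algebra_simps)

lemma rat_eval_smult: "rat_eval (smult a q) z = of_rat a * rat_eval q z"
  by (induction q) (simp_all add: of_rat_mult algebra_simps)

lemma rat_eval_mult: "rat_eval (q * r) z = rat_eval q z * rat_eval r z"
  by (induction q) (simp_all add: rat_eval_add rat_eval_smult algebra_simps)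

lemma rat_eval_power: "rat_eval (q ^ n) z = rat_eval q z ^ n"
  by (induction n) (simp_all add: rat_eval_mult one_pCons)

lemma map_poly_of_rat_pderiv:
  "pderiv (map_poly of_rat q) = (map_poly of_rat (pderiv q) :: complex poly)"
  by (rule poly_eqI) (simp add: coeff_pderiv coeff_map_poly of_rat_mult of_rat_add)

text \<open>
  A nonzero rational polynomial \<open>m\<close> of least degree that vanishes at \<open>\<alpha>\<close> divides both \<open>f\<close> and \<open>g\<close>,
  so all its complex roots equal \<open>\<alpha>\<close>. If its degree were at least \<open>2\<close>, then \<open>\<alpha>\<close> would be a multiple root
  and the derivative of \<open>m\<close> a smaller polynomial vanishing at \<open>\<alpha>\<close>. So \<open>m\<close> is linear.
\<close>

lemma Rats_if_only_common_root:
  fixes \<alpha> :: complex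
  assumes f: "f \<noteq> 0" "rat_eval f \<alpha> = 0" and g: "rat_eval g \<alpha> = 0"
    and only: "\<And>z. rat_eval f z = 0 \<Longrightarrow> rat_eval g z = 0 \<Longrightarrow> z = \<alpha>"
  shows "\<alpha> \<in> \<rat>"
proof -
  obtain m where m: "m \<noteq> 0" "rat_eval m \<alpha> = 0"
    and min: "\<And>q. q \<noteq> 0 \<Longrightarrow> rat_eval q \<alpha> = 0 \<Longrightarrow> degree m \<le> degree q"
    using ex_has_least_nat[of "\<lambda>q. q \<noteq> 0 \<and> rat_eval q \<alpha> = 0" f degree] f by auto
  have dvd: "m dvd q" if "rat_eval q \<alpha> = 0" for q
  proof -
    have "rat_eval (q mod m) \<alpha> = 0"
      using that m rat_eval_add[of "q div m * m" "q mod m" \<alpha>] by (simp add: rat_eval_mult)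
    then have "q mod m = 0"
      using min[of "q mod m"] degree_mod_less[OF m(1), of q] by fastforce
    then show ?thesis by auto
  qed
  have root: "z = \<alpha>" if "rat_eval m z = 0" for z
    using dvd[OF f(2)] dvd[OF g] that by (intro only) (auto simp: rat_eval_mult)
  define h :: "complex poly" where "h = map_poly of_rat m"
  have h: "h \<noteq> 0" "degree h = degree m" "poly h \<alpha> = 0"
    using m by (auto simp: h_def rat_eval_def degree_map_poly map_poly_eq_0_iff)
  then obtain q where q: "h = [:- \<alpha>, 1:] * q" using poly_eq_0_iff_dvd by blast
  then have q0: "q \<noteq> 0" and degq: "degree m = Suc (degree q)"
    using h by (auto simp: degree_mult_eq simp del: mult_pCons_left)
  have "degree q = 0"
  proof (rule ccontr)
    assume deg: "degree q \<noteq> 0"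
    then obtain z where z: "poly q z = 0"
      using fundamental_theorem_of_algebra[of q] by (auto simp: constant_degree)
    then have "z = \<alpha>" using root[of z] q by (simp add: rat_eval_def h_def[symmetric])
    with z have "poly (pderiv h) \<alpha> = 0" by (simp add: q pderiv_mult pderiv_pCons del: mult_pCons_left)
    then have "rat_eval (pderiv m) \<alpha> = 0" by (simp add: h_def map_poly_of_rat_pderiv rat_eval_def)
    moreover have "pderiv m \<noteq> 0" using deg degq by (simp add: pderiv_eq_0_iff)
    ultimately show False using min[of "pderiv m"] degq by (simp add: degree_pderiv)
  qed
  then have "degree m = 1" using degq by simp
  then obtain a b where "m = [:a, b:]" "b \<noteq> 0"
    by (rule degree1_coeffs)
  then have "of_rat a + \<alpha> * of_rat b = 0" using m(2) by simp
  then have "\<alpha> = of_rat (- a / b)" using \<open>b \<noteq> 0\<close>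
    by (simp add: of_rat_divide of_rat_minus field_simps add_eq_0_iff2)
  then show ?thesis by simp
qed

text \<open>
  The number \<open>\<alpha>\<close> is a common root of the rational polynomials
  \<open>X ^ r - \<alpha> ^ r\<close> and \<open>(1 - X) ^ r - \<beta> ^ r\<close>. Any complex common root has the same distances from \<open>0\<close>
  and from \<open>1\<close> as \<open>\<alpha>\<close>; the two circles in question have their centres on the real axis and meet at the
  real point \<open>\<alpha>\<close>, so they are tangent and \<open>\<alpha>\<close> is their only common point.
\<close>

lemma Rats_if_radicals_add_to_1:
  fixes \<alpha> \<beta> :: real
  assumes sum: "\<alpha> + \<beta> = 1" and r: "r > 0" and rat: "\<alpha> ^ r \<in> \<rat>" "\<beta> ^ r \<in> \<rat>"
  shows "\<alpha> \<in> \<rat>"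
proof -
  from rat obtain A B where AB: "\<alpha> ^ r = of_rat A" "\<beta> ^ r = of_rat B"
    by (auto simp: Rats_def)
  have \<beta>: "\<beta> = 1 - \<alpha>" using sum by simp
  define f g :: "rat poly" where "f = [:0, 1:] ^ r + [:- A:]" and "g = [:1, -1:] ^ r + [:- B:]"
  have of_rat: "complex_of_real (of_rat q) = of_rat q" for q
    by (cases q) (simp add: of_rat_rat)
  have f: "rat_eval f z = z ^ r - of_real (\<alpha> ^ r)" for z
    by (simp add: f_def rat_eval_add rat_eval_power of_rat_minus AB of_rat)
  have g: "rat_eval g z = (1 - z) ^ r - of_real (\<beta> ^ r)" for z
    by (simp add: g_def rat_eval_add rat_eval_power of_rat_minus AB of_rat)
  have "of_real \<alpha> \<in> (\<rat> :: complex set)"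
  proof (rule Rats_if_only_common_root)
    show "f \<noteq> 0"
    proof
      assume "f = 0"
      then have "rat_eval f 0 = rat_eval f 1" by simp
      then show False using r by (simp add: f power_0_left)
    qed
    show "rat_eval f (of_real \<alpha>) = 0" "rat_eval g (of_real \<alpha>) = 0"
      by (simp_all add: f g \<beta>)
    fix z assume "rat_eval f z = 0" "rat_eval g z = 0"
    then have "z ^ r = of_real \<alpha> ^ r" "(1 - z) ^ r = of_real \<beta> ^ r" by (simp_all add: f g)
    then have "norm z ^ r = \<bar>\<alpha>\<bar> ^ r" "norm (1 - z) ^ r = \<bar>\<beta>\<bar> ^ r"
      by (metis norm_of_real norm_power)+
    then have "norm z = \<bar>\<alpha>\<bar>" "norm (1 - z) = \<bar>1 - \<alpha>\<bar>"
      using r by (auto simp: \<beta> intro: power_eq_imp_eq_base)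
    then have "(Re z)\<^sup>2 + (Im z)\<^sup>2 = \<alpha>\<^sup>2" "(1 - Re z)\<^sup>2 + (Im z)\<^sup>2 = (1 - \<alpha>)\<^sup>2"
      using cmod_power2[of z] cmod_power2[of "1 - z"] by auto
    then have "Re z = \<alpha>" "(Im z)\<^sup>2 = 0" by (auto simp: power2_eq_square algebra_simps)
    then show "z = of_real \<alpha>" by (simp add: complex_eq_iff)
  qed
  then obtain q where "complex_of_real \<alpha> = of_rat q" by (auto simp: Rats_def)
  then have "complex_of_real \<alpha> = of_real (of_rat q)" by (simp add: of_rat)
  then have "\<alpha> = of_rat q" by (simp only: of_real_eq_iff)
  then show ?thesis by simp
qed

section \<open>Sets whose differences have levels\<close>

text \<open>
  What the upper bounds use of the points \<open>(M\<^sup>T)\<^sup>n w\<close> with \<open>w\<close> a zero of the transform of the digit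
  measure: with \<open>R = 1 / \<rho>\<close> and \<open>\<kappa> = c \<rho>\<close>, the matrix \<open>(M\<^sup>T)\<^sup>n\<close> sends \<open>(x, y)\<close> to
  \<open>R ^ n (x, y + n \<kappa> x)\<close>, where the first coordinate \<open>x = k / p\<close> of a zero has valuation \<open>-1\<close>, and \<open>y\<close>
  is rational.
\<close>

definition level :: "nat \<Rightarrow> real \<Rightarrow> real \<Rightarrow> nat \<Rightarrow> (real^2) set" where
  "level p R \<kappa> n = {z. \<exists>k::int. \<exists>y\<in>\<rat>. \<not> int p dvd k \<and>
     z $ 1 = R ^ n * (of_int k / real p) \<and> z $ 2 = real n * \<kappa> * z $ 1 + R ^ n * y}"

lemma levelE:
  assumes "z \<in> level p R \<kappa> n"
  obtains k y where "\<not> int p dvd k" "y \<in> \<rat>" "z $ 1 = R ^ n * (of_int k / real p)"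
    "z $ 2 = real n * \<kappa> * z $ 1 + R ^ n * y"
  using assms by (auto simp: level_def)

lemma uminus_level: "- z \<in> level p R \<kappa> n" if "z \<in> level p R \<kappa> n"
proof -
  obtain k y where *: "\<not> int p dvd k" "y \<in> \<rat>" "z $ 1 = R ^ n * (of_int k / real p)"
    "z $ 2 = real n * \<kappa> * z $ 1 + R ^ n * y"
    using \<open>z \<in> level p R \<kappa> n\<close> by (rule levelE)
  show ?thesis
    unfolding level_def using *(1,2)
    by (auto intro!: exI[of _ "- k"] bexI[of _ "- y"] simp: *(3,4) algebra_simps)
qed

context
  fixes p r :: nat and R \<tau> \<kappa> :: real and v :: int
  assumes p: "prime p" and R: "R > 0" "R ^ r = \<tau>" and r: "r > 0" and v: "padic_val p v \<tau>"
begin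

lemma level_nonzero: "z \<in> level p R \<kappa> n \<Longrightarrow> z $ 1 \<noteq> 0"
  using R(1) prime_gt_0_nat[OF p] by (auto simp: level_def)

text \<open>
  The powers of \<open>R\<close> themselves may be irrational, but the \<open>r\<close>-th power of a quotient of first
  coordinates is rational with a valuation that records the difference of the levels.
\<close>

lemma padic_val_ratio_power:
  assumes z: "z \<in> level p R \<kappa> n" and w: "w \<in> level p R \<kappa> m"
  shows "padic_val p (v * (int n - int m)) ((z $ 1 / w $ 1) ^ r)"
proof -
  obtain k where k: "\<not> int p dvd k" "z $ 1 = R ^ n * (of_int k / real p)"
    using z by (rule levelE)
  obtain l where l: "\<not> int p dvd l" "w $ 1 = R ^ m * (of_int l / real p)"
    using w by (rule levelE)
  have "z $ 1 / w $ 1 = R powi (int n - int m) * (of_int k / of_int l)"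
    using R(1) prime_gt_0_nat[OF p] by (simp add: k l power_int_diff)
  then have "(z $ 1 / w $ 1) ^ r = \<tau> powi (int n - int m) * (of_int k / of_int l) ^ r"
    by (simp only: power_mult_distrib power_int_power power_int_power' mult.commute[of "int r"] flip: R(2))
  moreover have "padic_val p 0 (of_int k / of_int l)"
    using padic_val_divide[OF p padic_val_of_int[OF p k(1)] padic_val_of_int[OF p l(1)]] by simp
  then have "padic_val p 0 ((of_int k / of_int l) ^ r)"
    using padic_val_power[OF p] by fastforce
  moreover have "padic_val p ((int n - int m) * v) (\<tau> powi (int n - int m))"
    by (rule padic_val_power_int[OF p v])
  ultimately show ?thesis
    using padic_val_mult[OF p] by (fastforce simp: mult.commute)
qed

lemma padic_val_ratio:
  assumes z: "z \<in> level p R \<kappa> n" and w: "w \<in> level p R \<kappa> m" and "z $ 1 / w $ 1 \<in> \<rat>"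
  obtains i where "padic_val p i (z $ 1 / w $ 1)" "int r * i = v * (int n - int m)"
  using padic_val_of_power[OF p assms(3) padic_val_ratio_power[OF z w]] r by blast

text \<open>
  The first coordinates of \<open>w\<close> and \<open>z - w\<close> add up to that of \<open>z\<close>, so the two quotients are
  radicals with sum \<open>1\<close>.
\<close>

lemma ratio_rational:
  assumes z: "z \<in> level p R \<kappa> n" and w: "w \<in> level p R \<kappa> m" and zw: "z - w \<in> level p R \<kappa> l"
  shows "w $ 1 / z $ 1 \<in> \<rat>" "(z - w) $ 1 / z $ 1 \<in> \<rat>"
proof -
  have sum: "w $ 1 / z $ 1 + (z - w) $ 1 / z $ 1 = 1"
    using level_nonzero[OF z] by (simp add: field_simps)
  show "w $ 1 / z $ 1 \<in> \<rat>"
    by (rule Rats_if_radicals_add_to_1[OF sum r])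
      (rule padic_val_imp_Rats[OF padic_val_ratio_power[OF w z]]
        padic_val_imp_Rats[OF padic_val_ratio_power[OF zw z]])+
  have "(z - w) $ 1 / z $ 1 = 1 - w $ 1 / z $ 1" using sum by linarith
  then show "(z - w) $ 1 / z $ 1 \<in> \<rat>" using \<open>w $ 1 / z $ 1 \<in> \<rat>\<close> by simp
qed

text \<open>
  If \<open>R ^ r\<close> is a \<open>p\<close>-adic unit, then differences of different levels can occur together, but this is
  harmless: after division by one of the first coordinates
  all differences of first coordinates are rational, and their \<open>r\<close>-th powers are \<open>p\<close>-adic units.
\<close>

lemma card_le_if_unit_ratio:
  assumes v0: "v = 0"
    and L: "\<And>x y. x \<in> L \<Longrightarrow> y \<in> L \<Longrightarrow> x \<noteq> y \<Longrightarrow> \<exists>n. x - y \<in> level p R \<kappa> n"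
  shows "finite L \<and> card L \<le> p"
proof (cases "\<exists>x0\<in>L. \<exists>x1\<in>L. x0 \<noteq> x1")
  case True
  then obtain x0 x1 where x: "x0 \<in> L" "x1 \<in> L" "x0 \<noteq> x1" by blast
  define w where "w = x1 - x0"
  obtain m where w: "w \<in> level p R \<kappa> m" using L x by (auto simp: w_def)
  have rat: "(x - x0) $ 1 / w $ 1 \<in> \<rat>" if xL: "x \<in> L" for x
  proof (cases "x = x0 \<or> x = x1")
    case False
    obtain n l where "x - x0 \<in> level p R \<kappa> n" "w - (x - x0) \<in> level p R \<kappa> l"
      using L[OF xL x(1)] L[OF x(2) xL] False by (auto simp: w_def)
    then show ?thesis using ratio_rational(1)[OF w] by blast
  qed (use level_nonzero[OF w] in \<open>auto simp: w_def\<close>)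
  show ?thesis
  proof (rule card_le_if_differences_padic_units[OF p])
    fix x y assume xy: "x \<in> L" "y \<in> L" "x \<noteq> y"
    obtain n where n: "x - y \<in> level p R \<kappa> n" using L[OF xy] by blast
    have "(x - y) $ 1 / w $ 1 = (x - x0) $ 1 / w $ 1 - (y - x0) $ 1 / w $ 1"
      by (simp add: diff_divide_distrib)
    then have "(x - y) $ 1 / w $ 1 \<in> \<rat>" using rat xy by simp
    then obtain i where "padic_val p i ((x - y) $ 1 / w $ 1)" "int r * i = v * (int n - int m)"
      using padic_val_ratio[OF n w] by blast
    then show "padic_val p 0 (x $ 1 / w $ 1 - y $ 1 / w $ 1)"
      using v0 r by (simp add: diff_divide_distrib)
  qed
next
  case False
  then have "L = {} \<or> (\<exists>x. L = {x})" by blast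
  then show ?thesis using prime_gt_0_nat[OF p] by auto
qed

lemma irrational_multiple:
  assumes "\<kappa> \<notin> \<rat>" "a \<in> \<rat>" "b \<in> \<rat>" "a * \<kappa> = b"
  shows "a = 0"
  using assms by (metis Rats_divide nonzero_mult_div_cancel_left)

text \<open>
  Divide the three points by the first coordinate of \<open>z\<close> and write \<open>\<alpha> + \<beta> = 1\<close> for the resulting relation.
  Since \<open>\<kappa>\<close> is irrational, the second coordinates yield \<open>n = \<alpha> m + \<beta> l\<close>, so that the levels are
  either all equal or pairwise distinct. In the latter case \<open>\<alpha>\<close>, \<open>\<beta>\<close> and \<open>1\<close> have pairwise distinct
  valuations because \<open>v \<noteq> 0\<close>, against the ultrametric law.
\<close>

lemma same_level:
  assumes v0: "v \<noteq> 0" and \<kappa>: "\<kappa> \<notin> \<rat>"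
    and z: "z \<in> level p R \<kappa> n" and w: "w \<in> level p R \<kappa> m" and zw: "z - w \<in> level p R \<kappa> l"
  shows "m = n \<and> l = n"
proof (rule ccontr)
  assume neq: "\<not> ?thesis"
  define \<alpha> \<beta> where "\<alpha> = w $ 1 / z $ 1" and "\<beta> = (z - w) $ 1 / z $ 1"
  have nz: "z $ 1 \<noteq> 0" "w $ 1 \<noteq> 0" "(z - w) $ 1 \<noteq> 0"
    using level_nonzero z w zw by blast+
  then have \<alpha>\<beta>: "\<alpha> + \<beta> = 1" "\<alpha> \<noteq> 0" "\<beta> \<noteq> 0" by (auto simp: \<alpha>_def \<beta>_def field_simps)
  have rat: "\<alpha> \<in> \<rat>" "\<beta> \<in> \<rat>"
    using ratio_rational[OF z w zw] by (auto simp: \<alpha>_def \<beta>_def)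
  have slope: "\<exists>q\<in>\<rat>. u $ 2 = (real i * \<kappa> + q) * u $ 1" if u: "u \<in> level p R \<kappa> i" for u i
  proof -
    obtain k y where *: "\<not> int p dvd k" "y \<in> \<rat>" "u $ 1 = R ^ i * (of_int k / real p)"
      "u $ 2 = real i * \<kappa> * u $ 1 + R ^ i * y"
      using u by (rule levelE)
    show ?thesis
    proof (rule bexI[of _ "y / (of_int k / real p)"])
      show "u $ 2 = (real i * \<kappa> + y / (of_int k / real p)) * u $ 1"
        using *(1) prime_gt_0_nat[OF p] by (auto simp: *(3,4) field_simps)
    qed (use *(2) in simp)
  qed
  obtain q1 q2 q3 where q: "q1 \<in> \<rat>" "q2 \<in> \<rat>" "q3 \<in> \<rat>"
    "z $ 2 = (real n * \<kappa> + q1) * z $ 1" "w $ 2 = (real m * \<kappa> + q2) * w $ 1"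
    "(z - w) $ 2 = (real l * \<kappa> + q3) * (z - w) $ 1"
    using slope[OF z] slope[OF w] slope[OF zw] by blast
  have "real n * \<kappa> + q1 = z $ 2 / z $ 1" using q(4) nz(1) by simp
  also have "\<dots> = w $ 2 / z $ 1 + (z - w) $ 2 / z $ 1" by (simp add: diff_divide_distrib)
  also have "\<dots> = (real m * \<kappa> + q2) * \<alpha> + (real l * \<kappa> + q3) * \<beta>"
    unfolding q(5,6) \<alpha>_def \<beta>_def by (simp only: times_divide_eq_right)
  finally have "real n * \<kappa> + q1 = (real m * \<kappa> + q2) * \<alpha> + (real l * \<kappa> + q3) * \<beta>" .
  then have "(real n - \<alpha> * real m - \<beta> * real l) * \<kappa> = q2 * \<alpha> + q3 * \<beta> - q1"
    by (simp add: algebra_simps)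
  then have "real n - \<alpha> * real m - \<beta> * real l = 0"
    using q(1-3) rat by (intro irrational_multiple[OF \<kappa>]) auto
  then have "\<alpha> * (real m - real n) + \<beta> * (real l - real n) = (1 - (\<alpha> + \<beta>)) * real n"
    by (simp add: algebra_simps)
  then have lin: "\<alpha> * (real m - real n) + \<beta> * (real l - real n) = 0" by (simp add: \<alpha>\<beta>(1))
  have distinct: "m \<noteq> n" "l \<noteq> n" "m \<noteq> l"
  proof -
    show "m \<noteq> n" "l \<noteq> n" using lin \<alpha>\<beta>(2,3) neq by auto
    have "(\<alpha> + \<beta>) * (real m - real n) = 0" if "m = l" using lin that by (simp add: algebra_simps)
    then show "m \<noteq> l" using \<alpha>\<beta>(1) \<open>m \<noteq> n\<close> by auto
  qed
  obtain i where i: "padic_val p i \<alpha>" "int r * i = v * (int m - int n)"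
    using padic_val_ratio[OF w z] rat by (auto simp: \<alpha>_def)
  obtain j where j: "padic_val p j \<beta>" "int r * j = v * (int l - int n)"
    using padic_val_ratio[OF zw z] rat by (auto simp: \<beta>_def)
  have ij: "i \<noteq> 0" "j \<noteq> 0" "i \<noteq> j" using i(2) j(2) v0 distinct by auto
  have "padic_val p (min i j) (\<alpha> + \<beta>)"
    using padic_val_add[OF p i(1) j(1)] padic_val_add[OF p j(1) i(1)] ij(3)
    by (cases "i < j") (auto simp: min_def add.commute)
  then have "min i j = 0"
    using padic_val_unique[OF p] padic_val_1[OF p] \<alpha>\<beta>(1) by metis
  then show False using ij by (auto simp: min_def split: if_splits)
qed

text \<open>
  By \<open>same_level\<close>, applied to triples of points, all differences lie in one level \<open>n\<close>, and scaling
  first coordinates by \<open>p / R ^ n\<close> turns their differences into integers prime to \<open>p\<close>.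
\<close>

lemma card_le_if_irrational_shear:
  assumes v0: "v \<noteq> 0" and \<kappa>: "\<kappa> \<notin> \<rat>"
    and L: "\<And>x y. x \<in> L \<Longrightarrow> y \<in> L \<Longrightarrow> x \<noteq> y \<Longrightarrow> \<exists>n. x - y \<in> level p R \<kappa> n"
  shows "finite L \<and> card L \<le> p"
proof (cases "\<exists>x0\<in>L. \<exists>x1\<in>L. x0 \<noteq> x1")
  case True
  then obtain x0 x1 where x: "x0 \<in> L" "x1 \<in> L" "x0 \<noteq> x1" by blast
  obtain n where n: "x1 - x0 \<in> level p R \<kappa> n" using L x by blast
  have base: "x - x0 \<in> level p R \<kappa> n" if xL: "x \<in> L" "x \<noteq> x0" for x
  proof (cases "x = x1")
    case False
    obtain m l where "x - x0 \<in> level p R \<kappa> m" "(x1 - x0) - (x - x0) \<in> level p R \<kappa> l"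
      using L[OF xL(1) x(1)] L[OF x(2) xL(1)] False xL by auto
    then show ?thesis using same_level[OF v0 \<kappa> n] by blast
  qed (use n in simp)
  have all: "x - y \<in> level p R \<kappa> n" if xy: "x \<in> L" "y \<in> L" "x \<noteq> y" for x y
  proof -
    consider "y = x0" | "x = x0" | "x \<noteq> x0" "y \<noteq> x0" by blast
    then show ?thesis
    proof cases
      case 1 then show ?thesis using base xy by simp
    next
      case 2 then show ?thesis using uminus_level[OF base[of y]] xy by simp
    next
      case 3
      obtain l where "(x - x0) - (y - x0) \<in> level p R \<kappa> l" using L[OF xy] by auto
      then show ?thesis
        using same_level[OF v0 \<kappa> base[OF xy(1) 3(1)] base[OF xy(2) 3(2)]] by auto
    qed
  qed
  show ?thesis
  proof (rule card_le_if_differences_padic_units[OF p])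
    fix x y assume xy: "x \<in> L" "y \<in> L" "x \<noteq> y"
    obtain k where "\<not> int p dvd k" "(x - y) $ 1 = R ^ n * (of_int k / real p)"
      using all[OF xy] by (rule levelE)
    then show "padic_val p 0 (x $ 1 * real p / R ^ n - y $ 1 * real p / R ^ n)"
      using padic_val_of_int[OF p, of k] R(1) prime_gt_0_nat[OF p]
      by (simp add: field_simps)
  qed
next
  case False
  then have "L = {} \<or> (\<exists>x. L = {x})" by blast
  then show ?thesis using prime_gt_0_nat[OF p] by auto
qed

end

section \<open>Powers of the transposed matrix\<close>

lemma matrix_inv_eq:
  fixes A :: "'a::semiring_1^'n^'m"
  assumes "A ** B = mat 1" "B ** A = mat 1"
  shows "matrix_inv A = B"
proof -
  have "A ** matrix_inv A = mat 1 \<and> matrix_inv A ** A = mat 1"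
    unfolding matrix_inv_def
    using someI[of "\<lambda>A'. A ** A' = mat 1 \<and> A' ** A = mat 1" B] assms by simp
  then have "matrix_inv A = matrix_inv A ** (A ** B)" using assms by simp
  also have "\<dots> = B" using \<open>_ \<and> _\<close> by (simp add: matrix_mul_assoc)
  finally show ?thesis .
qed

lemma integer_lattice_iff: "z \<in> integer_lattice \<longleftrightarrow> z $ 1 \<in> \<int> \<and> z $ 2 \<in> \<int>"
  by (simp add: integer_lattice_def forall_2)

text \<open>
  The \<open>n\<close>-th power of the matrix with rows \<open>(R, 0)\<close> and \<open>(R \<kappa>, R)\<close>. With \<open>R = 1 / \<rho>\<close> and \<open>\<kappa> = c \<rho>\<close> it
  is \<open>(M\<^sup>T)\<^sup>n\<close>; the inverse of that is obtained from \<open>1 / R\<close> and \<open>- \<kappa>\<close>.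
\<close>

definition shear_scale :: "real \<Rightarrow> real \<Rightarrow> nat \<Rightarrow> real^2 \<Rightarrow> real^2" where
  "shear_scale R \<kappa> n x = vector [R ^ n * x $ 1, R ^ n * (x $ 2 + real n * \<kappa> * x $ 1)]"

lemma shear_scale_nth [simp]:
  "shear_scale R \<kappa> n x $ 1 = R ^ n * x $ 1"
  "shear_scale R \<kappa> n x $ 2 = R ^ n * (x $ 2 + real n * \<kappa> * x $ 1)"
  by (simp_all add: shear_scale_def)

lemma vec2_eq_iff: "x = y \<longleftrightarrow> x $ 1 = y $ 1 \<and> x $ 2 = y $ 2" for x y :: "real^2"
  by (simp add: vec_eq_iff forall_2)

lemma shear_scale_0 [simp]: "shear_scale R \<kappa> 0 x = x"
  by (simp add: vec2_eq_iff)

lemma shear_scale_add: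
  "shear_scale R \<kappa> m (shear_scale R \<kappa> n x) = shear_scale R \<kappa> (m + n) x"
  by (simp add: vec2_eq_iff power_add algebra_simps)

lemma shear_scale_diff:
  "shear_scale R \<kappa> n (x - y) = shear_scale R \<kappa> n x - shear_scale R \<kappa> n y"
  by (simp add: vec2_eq_iff algebra_simps)

lemma shear_scale_inverse:
  "R \<noteq> 0 \<Longrightarrow> shear_scale (inverse R) (- \<kappa>) n (shear_scale R \<kappa> n x) = x"
  "R \<noteq> 0 \<Longrightarrow> shear_scale R \<kappa> n (shear_scale (inverse R) (- \<kappa>) n x) = x"
  by (simp_all add: vec2_eq_iff field_simps)

lemma shear_scale_tendsto_0:
  assumes "0 < \<rho>" "\<rho> < 1"
  shows "(\<lambda>n. shear_scale \<rho> \<kappa> n x) \<longlonglongrightarrow> 0"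
proof (rule vec_tendstoI)
  fix i :: 2
  have 1: "(\<lambda>n. \<rho> ^ n) \<longlonglongrightarrow> 0" using assms by (intro LIMSEQ_realpow_zero) auto
  have 2: "(\<lambda>n. real n * \<rho> ^ n) \<longlonglongrightarrow> 0" using assms by (intro powser_times_n_limit_0) auto
  have "(\<lambda>n. \<rho> ^ n * x $ 1) \<longlonglongrightarrow> 0 * x $ 1" by (intro tendsto_intros 1)
  moreover have "(\<lambda>n. \<rho> ^ n * x $ 2 + real n * \<rho> ^ n * (\<kappa> * x $ 1)) \<longlonglongrightarrow> 0 * x $ 2 + 0 * (\<kappa> * x $ 1)"
    by (intro tendsto_intros 1 2)
  ultimately show "(\<lambda>n. shear_scale \<rho> \<kappa> n x $ i) \<longlonglongrightarrow> 0 $ i"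
    using exhaust_2[of i] by (auto simp: algebra_simps)
qed

lemma transpose_matrix_inv_jordan_block:
  assumes "\<rho> \<noteq> 0"
  shows "transpose (matrix_inv (vector [vector [inverse \<rho>, c], vector [0, inverse \<rho>]] :: real^2^2)) *v \<xi>
    = shear_scale \<rho> (- (c * \<rho>)) 1 \<xi>"
proof -
  have "matrix_inv (vector [vector [inverse \<rho>, c], vector [0, inverse \<rho>]] :: real^2^2)
     = vector [vector [\<rho>, - c * \<rho>\<^sup>2], vector [0, \<rho>]]"
    using assms by (intro matrix_inv_eq)
      (simp_all add: vec_eq_iff forall_2 matrix_matrix_mult_def sum_2 mat_def power2_eq_square)
  then show ?thesis
    by (simp add: vec2_eq_iff matrix_vector_mult_def transpose_def sum_2 power2_eq_square algebra_simps)
qed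


section \<open>Orthogonality and zeros of the Fourier transform\<close>

lemma fourier_uminus: "fourier \<mu> (- \<xi>) = cnj (fourier \<mu> \<xi>)"
proof -
  have "exponential (- \<xi>) = (\<lambda>x. cnj (exponential \<xi> x))"
    by (simp add: exponential_def exp_cnj fun_eq_iff)
  then show ?thesis by (simp add: fourier_eq)
qed

lemma LINT_exponential_cnj:
  "(LINT x|\<mu>. exponential \<xi> x * cnj (exponential \<eta> x)) = fourier \<mu> (\<xi> - \<eta>)"
proof -
  have "exponential \<xi> x * cnj (exponential \<eta> x) = exponential (\<xi> - \<eta>) x" for x
    by (simp add: exponential_def exp_cnj inner_diff_left algebra_simps flip: exp_add)
  then show ?thesis by (simp add: fourier_eq)
qed

lemma fourier_0: "prob_space \<mu> \<Longrightarrow> fourier \<mu> 0 = 1"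
  by (simp add: fourier_def prob_space.prob_space)

text \<open>
  The transform of \<open>\<mu>\<close> is a finite product of values of the transform of the digit measure, times a
  remaining factor \<open>fourier \<mu> (S n \<xi>)\<close>. The latter tends to \<open>1\<close> because the arguments contract to \<open>0\<close>,
  so for large \<open>n\<close> a zero has to come from the finite product.
\<close>

lemma fourier_zero_iff:
  assumes D: "finite D" "D \<noteq> {}" and \<rho>: "0 < \<rho>" "\<rho> < 1"
    and M: "M = vector [vector [inverse \<rho>, c], vector [0, inverse \<rho>]]"
    and \<mu>: "self_affine_measure M D \<mu>"
  shows "fourier \<mu> \<xi> = 0 \<longleftrightarrow>
     (\<exists>n\<ge>1. shear_scale \<rho> (- (c * \<rho>)) n \<xi> \<in> zero_set (fourier (uniform_dirac D)))"
proof -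
  define S where "S = shear_scale \<rho> (- c * \<rho>)"
  have step: "fourier \<mu> \<eta> = fourier (uniform_dirac D) (S 1 \<eta>) * fourier \<mu> (S 1 \<eta>)" for \<eta>
    using fourier_self_affine[OF D \<mu>, of \<eta>] \<rho> transpose_matrix_inv_jordan_block[of \<rho> c \<eta>]
    by (simp add: M S_def)
  have S_Suc: "S (Suc n) \<eta> = S 1 (S n \<eta>)" for n \<eta> by (simp add: S_def shear_scale_add)
  have prod: "fourier \<mu> \<xi> = (\<Prod>i=1..n. fourier (uniform_dirac D) (S i \<xi>)) * fourier \<mu> (S n \<xi>)" for n
  proof (induction n)
    case (Suc n)
    then show ?case using step[of "S n \<xi>", folded S_Suc] by simp
  qed (simp add: S_def)
  have "(\<lambda>n. fourier \<mu> (S n \<xi>)) \<longlonglongrightarrow> 1"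
    using \<mu> \<rho> unfolding S_def
    by (intro fourier_tendsto_1 shear_scale_tendsto_0) (auto simp: self_affine_measure_def)
  then have "\<forall>\<^sub>F n in sequentially. fourier \<mu> (S n \<xi>) \<noteq> 0"
    by (rule tendsto_imp_eventually_ne) simp
  then obtain N where N: "fourier \<mu> (S N \<xi>) \<noteq> 0" by (auto simp: eventually_sequentially)
  have "fourier \<mu> \<xi> = 0 \<longleftrightarrow> (\<exists>n\<ge>1. fourier (uniform_dirac D) (S n \<xi>) = 0)"
  proof
    assume "fourier \<mu> \<xi> = 0"
    then show "\<exists>n\<ge>1. fourier (uniform_dirac D) (S n \<xi>) = 0" using prod[of N] N by auto
  next
    assume "\<exists>n\<ge>1. fourier (uniform_dirac D) (S n \<xi>) = 0"
    then obtain n where "n \<ge> 1" "fourier (uniform_dirac D) (S n \<xi>) = 0" by blast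
    then show "fourier \<mu> \<xi> = 0" using prod[of n] by (auto simp: Bex_def)
  qed
  then show ?thesis by (simp add: S_def zero_set_def)
qed

lemma orthogonal_exponentials_bound:
  assumes L: "\<And>L. (\<And>x y. x \<in> L \<Longrightarrow> y \<in> L \<Longrightarrow> x \<noteq> y \<Longrightarrow> fourier \<mu> (x - y) = 0) \<Longrightarrow>
      finite L \<and> card L \<le> p"
    and F: "orthogonal_exponentials \<mu> F"
  shows "finite F \<and> card F \<le> p"
proof -
  define freq where "freq = inv exponential"
  have freq: "exponential (freq f) = f" if "f \<in> F" for f
    using F that by (auto simp: orthogonal_exponentials_def freq_def intro!: f_inv_into_f)
  have "finite (freq ` F) \<and> card (freq ` F) \<le> p"
  proof (rule L)
    fix x y assume "x \<in> freq ` F" "y \<in> freq ` F" "x \<noteq> y"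
    then obtain f g where fg: "f \<in> F" "g \<in> F" "x = freq f" "y = freq g" "f \<noteq> g" by auto
    then have "(LINT x|\<mu>. f x * cnj (g x)) = 0"
      using F by (auto simp: orthogonal_exponentials_def pairwise_def)
    then show "fourier \<mu> (x - y) = 0"
      using fg freq by (simp flip: LINT_exponential_cnj)
  qed
  moreover have "inj_on freq F" by (metis freq inj_onI)
  ultimately show ?thesis by (simp add: card_image finite_image_iff)
qed

text \<open>
  The frequencies are compared in one order only, since a transform vanishes at \<open>\<xi>\<close> if and only if it
  vanishes at \<open>- \<xi>\<close>. Orthogonality keeps the exponentials distinct: each has norm \<open>1\<close>.
\<close>

lemma orthogonal_exponentials_image:
  fixes g :: "nat \<Rightarrow> real^2"
  assumes \<mu>: "prob_space \<mu>" and I: "finite I"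
    and zero: "\<And>i j. i \<in> I \<Longrightarrow> j \<in> I \<Longrightarrow> i < j \<Longrightarrow> fourier \<mu> (g j - g i) = 0"
  shows "\<exists>F. orthogonal_exponentials \<mu> F \<and> finite F \<and> card F = card I"
proof -
  have orth: "(LINT x|\<mu>. exponential (g i) x * cnj (exponential (g j) x)) = 0"
    if "i \<in> I" "j \<in> I" "i \<noteq> j" for i j
  proof (cases "i < j")
    case True
    then show ?thesis
      using zero[of i j] that fourier_uminus[of \<mu> "g j - g i"] by (simp add: LINT_exponential_cnj)
  next
    case False
    then show ?thesis using zero[of j i] that by (simp add: LINT_exponential_cnj)
  qed
  have "inj_on (\<lambda>i. exponential (g i)) I"
  proof (rule inj_onI, rule ccontr)
    fix i j assume ij: "i \<in> I" "j \<in> I" "exponential (g i) = exponential (g j)" "i \<noteq> j"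
    have "fourier \<mu> (g i - g i) = 0"
      using orth[OF ij(1,2,4)] by (simp only: LINT_exponential_cnj flip: ij(3))
    then show False using fourier_0[OF \<mu>] by simp
  qed
  then have "card ((\<lambda>i. exponential (g i)) ` I) = card I" by (rule card_image)
  moreover have "orthogonal_exponentials \<mu> ((\<lambda>i. exponential (g i)) ` I)"
    unfolding orthogonal_exponentials_def pairwise_def using orth by auto
  ultimately show ?thesis using I by blast
qed

section \<open>Zeros of the digit transform\<close>

lemma E_setE:
  assumes "a \<in> E_set p"
  obtains i j :: int where "a $ 1 = of_int i" "a $ 2 = of_int j" "\<not> int p dvd i"
proof -
  from assms obtain i j where ij: "a = vector [real i, real j]" "i \<in> {1..p - 1}"
    by (auto simp: E_set_def)
  then have "\<not> p dvd i" by (auto dest!: dvd_imp_le)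
  then show thesis using ij by (intro that[of "int i" "int j"]) auto
qed

text \<open>
  The multiplier \<open>j\<close> in the description of the zeros matters only modulo \<open>p\<close>, the rest being
  absorbed by the lattice.
\<close>

lemma multiple_in_progression:
  fixes a :: "real^2"
  assumes p: "p > 0" and a: "a \<in> integer_lattice" and z: "z \<in> integer_lattice" and m: "\<not> int p dvd m"
  shows "(of_int m / real p) *\<^sub>R a + z
    \<in> (\<Union>j\<in>{1..p - 1}. {(real j / real p) *\<^sub>R a + z | z. z \<in> integer_lattice})"
proof -
  define j where "j = nat (m mod int p)"
  have "m mod int p \<noteq> 0" "m mod int p \<ge> 0" "m mod int p < int p" using m p by (auto simp: dvd_eq_mod_eq_0)
  then have j: "int j = m mod int p" "j \<in> {1..p - 1}" by (auto simp: j_def)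
  have "real_of_int m = of_int (m div int p) * real p + real j"
    using div_mult_mod_eq[of m "int p"] j(1) by (metis of_int_add of_int_mult of_int_of_nat_eq)
  then have "of_int m / real p = real j / real p + of_int (m div int p)"
    using p by (simp add: field_simps)
  then have "(of_int m / real p) *\<^sub>R a + z = (real j / real p) *\<^sub>R a + (of_int (m div int p) *\<^sub>R a + z)"
    by (simp add: scaleR_add_left)
  moreover have "of_int (m div int p) *\<^sub>R a + z \<in> integer_lattice"
    using a z by (simp add: integer_lattice_iff)
  ultimately show ?thesis using j(2) by blast
qed

lemma shear_scale_progression_in_level:
  assumes p: "prime p" and a: "a \<in> E_set p" and R: "R \<noteq> 0"
    and w: "w \<in> (\<Union>j\<in>{1..p - 1}. {(real j / real p) *\<^sub>R a + z | z. z \<in> integer_lattice})"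
  shows "shear_scale R \<kappa> n w \<in> level p R \<kappa> n"
proof -
  obtain i i' where i: "a $ 1 = of_int i" "a $ 2 = of_int i'" "\<not> int p dvd i"
    using a by (rule E_setE)
  from w obtain j z where j: "j \<in> {1..p - 1}" "z \<in> integer_lattice"
    "w = (real j / real p) *\<^sub>R a + z" by auto
  from j(2) obtain l l' where l: "z $ 1 = of_int l" "z $ 2 = of_int l'"
    by (auto simp: integer_lattice_iff elim!: Ints_cases)
  have "\<not> int p dvd int j * i"
    using i(3) j(1) p by (auto simp: prime_dvd_mult_iff dest!: dvd_imp_le)
  then have "\<not> int p dvd int j * i + int p * l" by (simp add: dvd_add_left_iff)
  moreover have "w $ 1 = of_int (int j * i + int p * l) / real p"
    using prime_gt_0_nat[OF p] by (simp add: j(3) i l field_simps)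
  moreover have "w $ 2 \<in> \<rat>" by (simp add: j(3) i l)
  ultimately show ?thesis
    unfolding level_def by (auto simp: algebra_simps intro!: exI[of _ "int j * i + int p * l"] bexI[of _ "w $ 2"])
qed

text \<open>
  The contraction that makes large orthogonal families possible when \<open>p\<close> divides \<open>s\<close>. It multiplies by
  \<open>(s / t) ^ (B d)\<close>: the power of \<open>s\<close> cancels the denominator \<open>p\<close>, the factor \<open>t ^ (B N)\<close> absorbs the powers of
  \<open>t\<close>, and since the exponent is a multiple of \<open>B\<close>, the shear is by an integer.
\<close>

lemma shear_scale_multiple_in_lattice:
  fixes a :: "real^2"
  assumes R: "R \<noteq> 0" "R ^ r = real t / real s" and s: "p dvd s" and pos: "s > 0" "t > 0" "p > 0" "B > 0"
    and \<kappa>: "real B * \<kappa> = of_int A" and a: "a \<in> integer_lattice" and d: "1 \<le> d" "d \<le> N"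
  shows "shear_scale (inverse R) (- \<kappa>) (r * B * d) ((real (t ^ (B * N)) / real p) *\<^sub>R a) \<in> integer_lattice"
proof -
  from s have "p dvd s ^ (B * d)" using pos d by (meson dvd_power dvd_trans nat_0_less_mult_iff less_le_trans zero_less_one)
  then obtain q where q: "s ^ (B * d) = p * q" by blast
  define Q where "Q = real (q * t ^ (B * (N - d)))"
  have "inverse R ^ (r * B * d) = inverse (R ^ r) ^ (B * d)"
    by (simp add: power_mult power_inverse mult.assoc)
  also have "\<dots> = real (s ^ (B * d)) / real (t ^ (B * d))" by (simp add: R(2) power_divide)
  also have "\<dots> = real p * real q / real (t ^ (B * d))" by (simp add: q)
  finally have R': "inverse R ^ (r * B * d) = real p * real q / real (t ^ (B * d))" .
  have t: "real (t ^ (B * N)) = real (t ^ (B * (N - d))) * real (t ^ (B * d))"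
    using d by (simp flip: power_add add: algebra_simps)
  have "inverse R ^ (r * B * d) * (real (t ^ (B * N)) / real p)
      = real p * real q / real (t ^ (B * d)) * (real (t ^ (B * (N - d))) * real (t ^ (B * d)) / real p)"
    by (simp only: R' t)
  also have "\<dots> = Q" using pos by (simp add: Q_def)
  finally have Q: "inverse R ^ (r * B * d) * (real (t ^ (B * N)) / real p) = Q" .
  have scale: "inverse R ^ (r * B * d) * (real (t ^ (B * N)) / real p * x + y * (real (t ^ (B * N)) / real p * x'))
      = Q * (x + y * x')" for x y x'
    by (simp add: Q[symmetric] ring_distribs mult_ac add_divide_distrib)
  have "real (r * B * d) * - \<kappa> = - (real r * real d * (real B * \<kappa>))" by simp
  also have "\<dots> = of_int (- (int r * int d * A))" by (simp add: \<kappa>)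
  finally have int: "real (r * B * d) * - \<kappa> \<in> \<int>" by (metis Ints_of_int)
  have "Q \<in> \<int>" by (simp add: Q_def)
  show ?thesis
    unfolding integer_lattice_iff shear_scale_nth vector_scaleR_component real_scaleR_def scale
    using scale[of "a $ 1" 0 0] \<open>Q \<in> \<int>\<close> int a 
    by (auto simp: integer_lattice_iff simp del: of_nat_mult mult_minus_right intro!: Ints_mult Ints_add)
qed


section \<open>Maximal orthogonal families\<close>

theorem theorem1p2:
  fixes p s t r :: nat and \<rho> c :: real and M :: "real^2^2"
    and D :: "(real^2) set" and \<mu> :: "(real^2) measure"
  assumes "prime p"
    and "0 < \<rho>" and "\<rho> < 1"
    and "M = vector [vector [inverse \<rho>, c], vector [0, inverse \<rho>]]"
    and "D \<subseteq> integer_lattice" and "card D = p"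
    and "\<exists>a \<in> E_set p. zero_set (fourier (uniform_dirac D)) =
           (\<Union>j\<in>{1..p - 1}. {(real j / real p) *\<^sub>R a + z | z. z \<in> integer_lattice})"
    and "self_affine_measure M D \<mu>"
    and "s \<ge> 1" and "t \<ge> 1" and "r \<ge> 1" and "coprime s t"
    and "inverse \<rho> = (real t / real s) powr (1 / real r)"
  shows "((\<forall>\<kappa>\<in>\<rat>. c \<noteq> \<kappa> * inverse \<rho>) \<longrightarrow>
            (\<forall>F. orthogonal_exponentials \<mu> F \<longrightarrow> finite F \<and> card F \<le> p) \<and>
            (\<exists>F. orthogonal_exponentials \<mu> F \<and> finite F \<and> card F = p))
       \<and> ((\<exists>\<kappa>\<in>\<rat>. c = \<kappa> * inverse \<rho>) \<and> \<not> p dvd t \<longrightarrow>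
            (\<not> p dvd s \<longrightarrow>
              (\<forall>F. orthogonal_exponentials \<mu> F \<longrightarrow> finite F \<and> card F \<le> p) \<and>
              (\<exists>F. orthogonal_exponentials \<mu> F \<and> finite F \<and> card F = p)) \<and>
            (p dvd s \<longrightarrow>
              (\<forall>N::nat. \<exists>F. orthogonal_exponentials \<mu> F \<and> finite F \<and> card F = N)))"
proof -
  note p = \<open>prime p\<close> and \<rho> = \<open>0 < \<rho>\<close> \<open>\<rho> < 1\<close>
  define R where "R = inverse \<rho>"
  define \<kappa> where "\<kappa> = c * \<rho>"
  define Z where "Z = zero_set (fourier (uniform_dirac D))"
  have ppos: "p > 0" using p by (rule prime_gt_0_nat)
  have D: "finite D" "D \<noteq> {}" using \<open>card D = p\<close> ppos by (auto simp: card_gt_0_iff)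
  have \<mu>: "prob_space \<mu>" using \<open>self_affine_measure M D \<mu>\<close> by (simp add: self_affine_measure_def)
  obtain a where a: "a \<in> E_set p" and
    Z: "Z = (\<Union>j\<in>{1..p - 1}. {(real j / real p) *\<^sub>R a + z | z. z \<in> integer_lattice})"
    using assms(7) by (auto simp: Z_def)
  have a_int: "a \<in> integer_lattice" using a by (elim E_setE) (simp add: integer_lattice_iff)
  have R: "R > 0" "R \<noteq> 0" "\<rho> = inverse R" using \<rho> by (auto simp: R_def)
  have R_power: "R ^ r = real t / real s"
    using assms(9-11) by (simp add: R_def assms(13) powr_power)
  have zero_iff: "fourier \<mu> \<xi> = 0 \<longleftrightarrow> (\<exists>n\<ge>1. shear_scale (inverse R) (- \<kappa>) n \<xi> \<in> Z)" for \<xi>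
    using fourier_zero_iff[OF D \<rho> assms(4,8)] by (simp add: Z_def R \<kappa>_def)
  have zero_level: "\<exists>n. \<xi> \<in> level p R \<kappa> n" if zero: "fourier \<mu> \<xi> = 0" for \<xi>
  proof -
    obtain n where "shear_scale (inverse R) (- \<kappa>) n \<xi> \<in> Z" using zero zero_iff by blast
    then have "shear_scale R \<kappa> n (shear_scale (inverse R) (- \<kappa>) n \<xi>) \<in> level p R \<kappa> n"
      using shear_scale_progression_in_level[OF p a R(2)] Z by blast
    then show ?thesis using R by (auto simp: shear_scale_inverse)
  qed

  obtain vt where vt: "padic_val p (int vt) (real t)" "vt > 0 \<longleftrightarrow> p dvd t"
    using padic_val_of_nat_exists[OF p, of t] \<open>t \<ge> 1\<close> by auto
  obtain vs where vs: "padic_val p (int vs) (real s)" "vs > 0 \<longleftrightarrow> p dvd s"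
    using padic_val_of_nat_exists[OF p, of s] \<open>s \<ge> 1\<close> by auto
  define v where "v = int vt - int vs"
  have v: "padic_val p v (real t / real s)"
    unfolding v_def by (rule padic_val_divide[OF p vt(1) vs(1)])
  \<comment> \<open>At most one of the two valuations is positive, so they cannot cancel in \<open>v\<close>.\<close>
  have "\<not> (p dvd t \<and> p dvd s)"
    using \<open>coprime s t\<close> p not_prime_unit by (metis coprime_common_divisor)
  then have v_iff: "v = 0 \<longleftrightarrow> \<not> p dvd t \<and> \<not> p dvd s"
    using vt(2) vs(2) by (auto simp: v_def)
  have r: "r > 0" using \<open>r \<ge> 1\<close> by simp

  have bound: "\<forall>F. orthogonal_exponentials \<mu> F \<longrightarrow> finite F \<and> card F \<le> p"
    if vk: "v = 0 \<or> \<kappa> \<notin> \<rat>"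
  proof (intro allI impI orthogonal_exponentials_bound)
    fix L :: "(real^2) set"
    assume "\<And>x y. x \<in> L \<Longrightarrow> y \<in> L \<Longrightarrow> x \<noteq> y \<Longrightarrow> fourier \<mu> (x - y) = 0"
    then have L: "\<exists>n. x - y \<in> level p R \<kappa> n" if "x \<in> L" "y \<in> L" "x \<noteq> y" for x y
      using zero_level that by blast
    show "finite L \<and> card L \<le> p"
      using card_le_if_unit_ratio[OF p R(1) R_power r v _ L]
        card_le_if_irrational_shear[OF p R(1) R_power r v _ _ L] vk by blast
  qed

  have attained: "\<exists>F. orthogonal_exponentials \<mu> F \<and> finite F \<and> card F = p"
  proof -
    \<comment> \<open>Pulled back by one step, the difference of two of these frequencies is a multiple of \<open>a / p\<close> by an
        integer prime to \<open>p\<close>, hence a zero of the digit transform.\<close>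
    define g where "g j = shear_scale R \<kappa> 1 ((real j / real p) *\<^sub>R a)" for j :: nat
    have zero: "fourier \<mu> (g j - g i) = 0" if ij: "i \<in> {0..<p}" "j \<in> {0..<p}" "i < j" for i j
    proof -
      have "shear_scale (inverse R) (- \<kappa>) 1 (g j - g i)
          = (real j / real p) *\<^sub>R a - (real i / real p) *\<^sub>R a"
        unfolding g_def shear_scale_diff[symmetric] by (rule shear_scale_inverse(1)[OF R(2)])
      also have "\<dots> = (of_int (int j - int i) / real p) *\<^sub>R a + 0"
        by (simp add: diff_divide_distrib scaleR_diff_left)
      also have "\<dots> \<in> Z"
        unfolding Z using ij ppos a_int
        by (intro multiple_in_progression) (auto simp: integer_lattice_iff dest!: zdvd_imp_le)
      finally show ?thesis using zero_iff by blast
    qed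
    show ?thesis
      using orthogonal_exponentials_image[where I = "{0..<p}" and g = g, OF \<mu> _ zero] by simp
  qed

  have unbounded: "\<exists>F. orthogonal_exponentials \<mu> F \<and> finite F \<and> card F = N"
    if \<kappa>: "\<kappa> \<in> \<rat>" and pt: "\<not> p dvd t" and ps: "p dvd s" for N
  proof -
    obtain A B' where AB': "B' > 0" "\<kappa> = of_int A / of_int B'" using \<kappa> by (rule Rats_cases')
    define B where "B = nat B'"
    have B: "B > 0" "real B * \<kappa> = of_int A" using AB' by (auto simp: B_def)
    \<comment> \<open>One frequency in each of the levels \<open>r B k\<close>. Pulled back to the higher level of a pair, the frequency of
        lower level becomes a lattice vector, so it does not affect whether the difference is a zero.\<close>
    define w where "w = (real (t ^ (B * N)) / real p) *\<^sub>R a"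
    define g where "g k = shear_scale R \<kappa> (r * B * k) w" for k
    have zero: "fourier \<mu> (g j - g i) = 0" if ij: "i \<in> {1..N}" "j \<in> {1..N}" "i < j" for i j
    proof -
      have split: "r * B * j = r * B * (j - i) + r * B * i"
        using ij(3) by (simp flip: add_mult_distrib2)
      define z where "z = shear_scale (inverse R) (- \<kappa>) (r * B * (j - i)) w"
      have "z \<in> integer_lattice"
        unfolding z_def w_def using ij assms(9,10) ppos
        by (intro shear_scale_multiple_in_lattice[OF R(2) R_power ps _ _ _ B(1,2) a_int]) auto
      have "shear_scale (inverse R) (- \<kappa>) (r * B * j) (g i) = z"
        unfolding split by (simp only: z_def g_def shear_scale_inverse(1)[OF R(2)] flip: shear_scale_add)
      moreover have "shear_scale (inverse R) (- \<kappa>) (r * B * j) (g j) = w"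
        unfolding g_def by (rule shear_scale_inverse(1)[OF R(2)])
      ultimately have "shear_scale (inverse R) (- \<kappa>) (r * B * j) (g j - g i)
          = (of_int (int (t ^ (B * N))) / real p) *\<^sub>R a + (- z)"
        by (simp add: shear_scale_diff w_def)
      also have "\<dots> \<in> Z"
      proof -
        have "\<not> p dvd t ^ (B * N)" using pt p prime_dvd_power by blast
        then have "\<not> int p dvd int (t ^ (B * N))" by (simp only: of_nat_dvd_iff not_False_eq_True)
        moreover have "- z \<in> integer_lattice" using \<open>z \<in> integer_lattice\<close> by (simp add: integer_lattice_iff)
        ultimately show ?thesis unfolding Z by (intro multiple_in_progression ppos a_int)
      qed
      finally have *: "shear_scale (inverse R) (- \<kappa>) (r * B * j) (g j - g i) \<in> Z" .
      have "r * B * j \<ge> 1" using r B(1) ij by simp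
      with * show ?thesis using zero_iff by blast
    qed
    show ?thesis
      using orthogonal_exponentials_image[where I = "{1..N}" and g = g, OF \<mu> _ zero] by simp
  qed

  have \<kappa>_iff: "(\<exists>q\<in>\<rat>. c = q * inverse \<rho>) \<longleftrightarrow> \<kappa> \<in> \<rat>"
    using \<rho> by (auto simp: \<kappa>_def field_simps)
  then have "(\<forall>q\<in>\<rat>. c \<noteq> q * inverse \<rho>) \<longleftrightarrow> \<kappa> \<notin> \<rat>" by blast
  then show ?thesis using \<kappa>_iff bound attained unbounded v_iff by blast
qed

end
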